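(* Let $a,b,c$ be integers with $a,b\ge 30$. (1) Suppose $0\le c\le 3$. Then the Halve Nim position $a^1b^1c^1$ is a $\mathcal{P}$-position if and only if $$a\oplus b=\tfrac12\bigl(3+(-1)^{c+1}\bigr)+(-1)^{\lfloor\log_2(a/7)\rfloor+\left(1+(-1)^{\lfloor c/2\rfloor+1}\right)/2}.$$ (2) Suppose $4\le c\le 7$. Then the Halve Nim position $a^1b^1c^1$ is a $\mathcal{P}$-position if and only if $$(a+2)\oplus(b+2)=c-2.$$
   Context: Halve Nim is a two-player game played on finitely many piles of coins; players alternate moves and a player who cannot move loses. A move is one of: (i) choose one pile and remove at least one coin from it; (ii) halve the game: simultaneously replace every pile of $m$ coins by a pile of $\lfloor m/2\rfloor$ coins. When there are no coins left, no move is available (halving requires at least one coin to be present). A position is a $\mathcal{P}$-position if the player who is not about to move has a winning strategy (equivalently, every move from it leads to an $\mathcal{N}$-position), and an $\mathcal{N}$-position if the player about to move has a winning strategy. For nonnegative integers $a,b,c$, $a^1b^1c^1$ denotes the position with three piles of sizes $a$, $b$, $c$ (a pile of size $0$ is an empty pile). $\oplus$ denotes bitwise XOR (Nim addition) of nonnegative integers. *)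

theory Defs
  imports Complex_Main "HOL-Library.Multiset"
begin

unbundle bit_operations_syntax

text \<open>
  A position is the multiset of its pile sizes; a pile of size 0 is an empty pile, from which
  nothing can be removed and which does not by itself enable halving.
\<close>

type_synonym position = "nat multiset"

inductive move :: "position \<Rightarrow> position \<Rightarrow> bool" where
  remove: "m \<in># G \<Longrightarrow> k < m \<Longrightarrow> move G (add_mset k (G - {#m#}))"
| halve: "\<exists>m\<in>#G. 0 < m \<Longrightarrow> move G (image_mset (\<lambda>m. m div 2) G)"

text \<open>
  A strategy maps each position to the position its user moves to. The predicate
  \<open>secures \<sigma> G\<close> states that the player who is not about to move at \<open>G\<close>, answering every move
  of the opponent according to \<open>\<sigma>\<close>, always has a legal answer and wins: whatever the
  opponent does, the opponent is unable to move after finitely many moves.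
\<close>

inductive secures :: "(position \<Rightarrow> position) \<Rightarrow> position \<Rightarrow> bool" for \<sigma> where
  secures: "(\<And>H. move G H \<Longrightarrow> move H (\<sigma> H) \<and> secures \<sigma> (\<sigma> H)) \<Longrightarrow> secures \<sigma> G"

definition P_position :: "position \<Rightarrow> bool" where
  "P_position G \<longleftrightarrow> (\<exists>\<sigma>. secures \<sigma> G)"

definition N_position :: "position \<Rightarrow> bool" where
  "N_position G \<longleftrightarrow> (\<exists>\<sigma>. move G (\<sigma> G) \<and> secures \<sigma> (\<sigma> G))"

lemma sum_mset_div2_le: "(\<Sum>m\<in>#G. m div 2) \<le> \<Sum>\<^sub># G" for G :: position
  by (induction G) auto

lemma move_sum_mset_less: "move G H \<Longrightarrow> \<Sum>\<^sub># H < \<Sum>\<^sub># G"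
proof (induction rule: move.induct)
  case (remove m G k)
  then obtain G' where "G = add_mset m G'"
    by (metis insert_DiffM)
  with remove show ?case by simp
next
  case (halve G)
  then obtain m G' where "0 < m" "G = add_mset m G'"
    by (metis insert_DiffM)
  moreover from this have "m div 2 < m" by simp
  ultimately show ?case
    using sum_mset_div2_le[of G'] by (simp add: add_less_le_mono)
qed

lemma N_position_iff: "N_position G \<longleftrightarrow> (\<exists>H. move G H \<and> P_position H)"
  and P_position_iff: "P_position G \<longleftrightarrow> (\<forall>H. move G H \<longrightarrow> N_position H)"
proof -
  define \<tau> where "\<tau> = (\<lambda>G. SOME H. move G H \<and> P_position H)"
  have \<tau>: "move G (\<tau> G) \<and> P_position (\<tau> G)" if "move G H" "P_position H" for G H
    unfolding \<tau>_def by (rule someI[of _ H]) (use that in blast)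
  have P_D: "\<exists>K. move H K \<and> P_position K" if "P_position G" "move G H" for G H
    using that unfolding P_position_def by (meson secures.cases)
  have uniform: "secures \<tau> G" if "P_position G" for G
    using that
  proof (induction "\<Sum>\<^sub># G" arbitrary: G rule: less_induct)
    case less
    show ?case
    proof (rule secures)
      fix H assume H: "move G H"
      then have *: "move H (\<tau> H)" "P_position (\<tau> H)"
        using P_D less.prems \<tau> by blast+
      then have "\<Sum>\<^sub># (\<tau> H) < \<Sum>\<^sub># G"
        using H move_sum_mset_less by (meson less_trans)
      with * less.hyps show "move H (\<tau> H) \<and> secures \<tau> (\<tau> H)" by blast
    qed
  qed
  show N: "N_position G \<longleftrightarrow> (\<exists>H. move G H \<and> P_position H)" for G
    unfolding N_position_def using \<tau> uniform P_position_def by blast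
  show "P_position G \<longleftrightarrow> (\<forall>H. move G H \<longrightarrow> N_position H)"
  proof
    assume "P_position G"
    then show "\<forall>H. move G H \<longrightarrow> N_position H"
      using P_D N by blast
  next
    assume "\<forall>H. move G H \<longrightarrow> N_position H"
    then have "secures \<tau> G"
      using N \<tau> uniform by (intro secures) blast
    then show "P_position G"
      unfolding P_position_def by blast
  qed
qed

end

(*
  For c < 8 each c and a admit exactly one b such that {#a, b, c#} is a P-position; call it the
  partner of a. The map a |-> partner is an involution, so a non-P-position {#a, b, c#} with a \<le> b
  can fail to have a winning removal from its two large piles only if b lies between a and the
  partner of a, and then lowering c or halving wins. For a \<ge> 30 the partner is given by XOR with a
  constant below 8, up to a shift by 2 and a case distinction on the parity of the octave
  [7 * 2 ^ j, 7 * 2 ^ (j + 1)) containing a, which halving flips. Hence everything relevant happens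
  within distance 16 of a multiple of 8, and after subtracting that multiple only finitely many
  configurations remain; the values a < 62 are checked directly.
*)

theory Submission
  imports Defs "HOL-Library.Discrete_Functions" "HOL-Library.Code_Binary_Nat"
begin

section \<open>Determinacy and a criterion for three piles\<close>

lemma N_position_iff_not_P_position: "N_position G \<longleftrightarrow> \<not> P_position G"
proof (induction "\<Sum>\<^sub># G" arbitrary: G rule: less_induct)
  case less
  then have "N_position H \<longleftrightarrow> \<not> P_position H" if "move G H" for H
    using that move_sum_mset_less by blast
  then show ?case
    using N_position_iff[of G] P_position_iff[of G] by blast
qed

lemma P_position_iff_moves: "P_position G \<longleftrightarrow> (\<forall>H. move G H \<longrightarrow> \<not> P_position H)"
  using P_position_iff N_position_iff_not_P_position by blast

lemma move_three_piles_iff: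
  "move {#a, b, c#} H \<longleftrightarrow>
     (\<exists>k<a. H = {#k, b, c#}) \<or> (\<exists>k<b. H = {#a, k, c#}) \<or> (\<exists>k<c. H = {#a, b, k#}) \<or>
     (0 < a + b + c \<and> H = {#a div 2, b div 2, c div 2#})"
proof
  assume "move {#a, b, c#} H"
  then show "(\<exists>k<a. H = {#k, b, c#}) \<or> (\<exists>k<b. H = {#a, k, c#}) \<or> (\<exists>k<c. H = {#a, b, k#}) \<or>
     (0 < a + b + c \<and> H = {#a div 2, b div 2, c div 2#})"
  proof cases
    case (remove m k)
    then consider "m = a" | "m = b" | "m = c" by auto
    then show ?thesis
    proof cases
      case 1
      then show ?thesis using remove by auto
    next
      case 2
      then have "H = {#a, k, c#}" using remove by (auto simp: add_mset_commute)
      then show ?thesis using 2 remove by blast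
    next
      case 3
      then have "H = {#a, b, k#}" using remove by (auto simp: add_mset_commute)
      then show ?thesis using 3 remove by blast
    qed
  next
    case halve
    then show ?thesis by auto
  qed
next
  assume "(\<exists>k<a. H = {#k, b, c#}) \<or> (\<exists>k<b. H = {#a, k, c#}) \<or> (\<exists>k<c. H = {#a, b, k#}) \<or>
     (0 < a + b + c \<and> H = {#a div 2, b div 2, c div 2#})"
  then show "move {#a, b, c#} H"
  proof (elim disjE exE conjE)
    fix k assume "k < a" "H = {#k, b, c#}"
    then show ?thesis using remove[of a "{#a, b, c#}" k] by simp
  next
    fix k assume "k < b" "H = {#a, k, c#}"
    then show ?thesis using remove[of b "{#a, b, c#}" k] by (simp add: add_mset_commute)
  next
    fix k assume "k < c" "H = {#a, b, k#}"
    then show ?thesis using remove[of c "{#a, b, c#}" k] by (simp add: add_mset_commute)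
  next
    assume "0 < a + b + c" "H = {#a div 2, b div 2, c div 2#}"
    then show ?thesis using halve[of "{#a, b, c#}"] by auto
  qed
qed

text \<open>Induction on the number of coins. \<open>involution\<close>, \<open>lower\<close> and
  \<open>halved\<close> exclude moves between two positions with \<open>g c a = b\<close>. From any
  other position, either a large pile can be cut down to its partner, or \<open>reach\<close>
  supplies a move on \<open>c\<close> or a halving. Symmetry in the large piles allows
  \<open>reach\<close> to assume \<open>a \<le> b\<close>.\<close>

lemma P_position_three_piles_iff:
  fixes g :: "nat \<Rightarrow> nat \<Rightarrow> nat"
  assumes involution: "\<And>c a. c < n \<Longrightarrow> g c (g c a) = a"
    and lower: "\<And>c d a. d < c \<Longrightarrow> c < n \<Longrightarrow> g d a \<noteq> g c a"
    and halved: "\<And>c a. c < n \<Longrightarrow> (a, c) \<noteq> (0, 0) \<Longrightarrow> g (c div 2) (a div 2) \<noteq> g c a div 2"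
    and reach: "\<And>a b c. c < n \<Longrightarrow> a \<le> b \<Longrightarrow> b < g c a \<Longrightarrow> a < g c b \<Longrightarrow>
       (\<exists>d<c. g d a = b) \<or> g (c div 2) (a div 2) = b div 2"
    and "c < n"
  shows "P_position {#a, b, c#} \<longleftrightarrow> g c a = b"
  using \<open>c < n\<close>
proof (induction "a + b + c" arbitrary: a b c rule: less_induct)
  case less
  have swap: "g d x = y \<longleftrightarrow> g d y = x" if "d < n" for d x y
    using involution[OF that] by metis
  \<comment> \<open>If \<open>0 < g 0 0\<close>, then \<open>reach\<close> at zero offers no
    \<open>d < 0\<close>, so its second alternative gives \<open>g 0 0 = 0\<close> anyway.\<close>
  have g00: "g 0 0 = 0"
    using reach[of 0 0 0] less.prems by fastforce
  have "P_position {#a, b, c#} \<longleftrightarrow>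
      (\<forall>k<a. \<not> P_position {#k, b, c#}) \<and> (\<forall>k<b. \<not> P_position {#a, k, c#}) \<and>
      (\<forall>k<c. \<not> P_position {#a, b, k#}) \<and>
      (0 < a + b + c \<longrightarrow> \<not> P_position {#a div 2, b div 2, c div 2#})"
    by (subst P_position_iff_moves) (auto simp: move_three_piles_iff)
  also have "\<dots> \<longleftrightarrow> (\<forall>k<a. g c k \<noteq> b) \<and> (\<forall>k<b. g c a \<noteq> k) \<and> (\<forall>k<c. g k a \<noteq> b) \<and>
      (0 < a + b + c \<longrightarrow> g (c div 2) (a div 2) \<noteq> b div 2)"
  proof -
    have "P_position {#a div 2, b div 2, c div 2#} \<longleftrightarrow> g (c div 2) (a div 2) = b div 2"
      if "0 < a + b + c"
    proof (rule less.hyps)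
      have "x div 2 < x" if "0 < x" for x :: nat
        using that by simp
      then show "a div 2 + b div 2 + c div 2 < a + b + c"
        using that by (cases "0 < a"; cases "0 < b"; cases "0 < c") linarith+
      show "c div 2 < n"
        using less.prems by simp
    qed
    moreover have "P_position {#k, b, c#} \<longleftrightarrow> g c k = b" if "k < a" for k
      by (rule less.hyps) (use that less.prems in auto)
    moreover have "P_position {#a, k, c#} \<longleftrightarrow> g c a = k" if "k < b" for k
      by (rule less.hyps) (use that less.prems in auto)
    moreover have "P_position {#a, b, k#} \<longleftrightarrow> g k a = b" if "k < c" for k
      by (rule less.hyps) (use that less.prems in auto)
    ultimately show ?thesis by simp
  qed
  also have "\<dots> \<longleftrightarrow> g c a = b"
  proof
    assume *: "g c a = b"
    have "g c k \<noteq> b" if "k < a" for k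
      using * swap less.prems that by (metis less_irrefl)
    \<comment> \<open>The case \<open>a = c = 0\<close> left out by \<open>halved\<close> would
      force \<open>b = g 0 0 = 0\<close>, an empty position.\<close>
    moreover have "g (c div 2) (a div 2) \<noteq> b div 2" if "0 < a + b + c"
      using halved[OF less.prems, of a] * that g00 by fastforce
    ultimately show "(\<forall>k<a. g c k \<noteq> b) \<and> (\<forall>k<b. g c a \<noteq> k) \<and> (\<forall>k<c. g k a \<noteq> b) \<and>
        (0 < a + b + c \<longrightarrow> g (c div 2) (a div 2) \<noteq> b div 2)"
      using * lower less.prems by auto
  next
    assume *: "(\<forall>k<a. g c k \<noteq> b) \<and> (\<forall>k<b. g c a \<noteq> k) \<and> (\<forall>k<c. g k a \<noteq> b) \<and>
        (0 < a + b + c \<longrightarrow> g (c div 2) (a div 2) \<noteq> b div 2)"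
    show "g c a = b"
    proof (rule ccontr)
      assume "g c a \<noteq> b"
      then have "b < g c a"
        using * by (metis linorder_neqE_nat)
      have "g c b \<noteq> a"
        using \<open>g c a \<noteq> b\<close> swap less.prems by blast
      moreover have "\<not> g c b < a"
        using * swap less.prems by blast
      ultimately have "a < g c b" by simp
      have "0 < a + b + c"
        using \<open>g c a \<noteq> b\<close> g00 by (cases "a + b + c = 0") auto
      then have no: "\<forall>k<c. g k a \<noteq> b" "g (c div 2) (a div 2) \<noteq> b div 2"
        using * by auto
      show False
      proof (cases "a \<le> b")
        case True
        then show False
          using reach[OF less.prems _ \<open>b < g c a\<close> \<open>a < g c b\<close>] no by blast
      next
        case False
        then have "(\<exists>d<c. g d b = a) \<or> g (c div 2) (b div 2) = a div 2"
          using reach[OF less.prems _ \<open>a < g c b\<close> \<open>b < g c a\<close>] by simp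
        moreover have "g d b \<noteq> a" if "d < c" for d
          using no(1) swap[of d b a] less.prems that by simp
        moreover have "g (c div 2) (b div 2) \<noteq> a div 2"
          using no(2) swap[of "c div 2" "b div 2" "a div 2"] less.prems by simp
        ultimately show False by blast
      qed
    qed
  qed
  finally show ?case .
qed


section \<open>The partner function: table and closed form\<close>

text \<open>Entry \<open>a\<close> of row \<open>c\<close> is the \<open>b\<close> completing \<open>a\<close> and \<open>c\<close> to a P-position.\<close>

definition small_partner :: "nat list list" where
  "small_partner =
   [[0, 2, 1, 3, 4, 5, 8, 9, 6, 7, 12, 13, 10, 11, 14, 15, 16, 17, 18, 19,
     20, 21, 22, 23, 24, 25, 26, 27, 30, 31],
    [2, 3, 0, 1, 5, 4, 9, 8, 7, 6, 13, 12, 11, 10, 15, 14, 17, 16, 19, 18,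
     21, 20, 23, 22, 25, 24, 27, 26, 31, 30],
    [1, 0, 2, 4, 3, 6, 5, 7, 8, 9, 10, 11, 12, 13, 18, 19, 20, 21, 14, 15,
     16, 17, 26, 27, 28, 29, 22, 23, 24, 25],
    [3, 1, 4, 0, 2, 7, 6, 5, 9, 8, 11, 10, 13, 12, 19, 18, 21, 20, 15, 14,
     17, 16, 27, 26, 29, 28, 23, 22, 25, 24],
    [4, 5, 3, 2, 0, 1, 7, 6, 10, 11, 8, 9, 14, 15, 12, 13, 18, 19, 16, 17,
     22, 23, 20, 21, 26, 27, 24, 25, 28, 29],
    [5, 4, 6, 7, 1, 0, 2, 3, 11, 10, 9, 8, 15, 14, 13, 12, 19, 18, 17, 16,
     23, 22, 21, 20, 27, 26, 25, 24, 29, 28],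
    [8, 9, 5, 6, 7, 2, 3, 4, 0, 1, 16, 17, 18, 19, 20, 21, 10, 11, 12, 13,
     14, 15, 24, 25, 22, 23, 28, 29, 26, 27],
    [9, 8, 7, 5, 6, 3, 4, 2, 1, 0, 17, 16, 19, 18, 21, 20, 11, 10, 13, 12,
     15, 14, 25, 24, 23, 22, 29, 28, 27, 26]]"

text \<open>The octave parity is a separate argument, so that finite checks can quantify over it and
  translating \<open>a\<close> leaves it fixed.\<close>

definition large_partner :: "bool \<Rightarrow> nat \<Rightarrow> nat \<Rightarrow> nat" where
  "large_partner e c a =
    (if c < 4 then a XOR (c XOR (if e then 2 else 0)) else ((a + 2) XOR (c - 2)) - 2)"

text \<open>For \<open>7 \<le> a\<close>, \<open>floor_log (a div 7)\<close> is the index of the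
  octave containing \<open>a\<close>, in integer arithmetic so that it can be evaluated.\<close>

definition even_octave :: "nat \<Rightarrow> bool" where
  "even_octave a \<longleftrightarrow> even (floor_log (a div 7))"

definition partner :: "nat \<Rightarrow> nat \<Rightarrow> nat" where
  "partner c a =
    (if a < 30 then small_partner ! c ! a else large_partner (even_octave a) c a)"

section \<open>Finite checks\<close>

text \<open>
  The finite checks below rewrite bounded quantifiers to lists, because \<open>code_simp\<close> is
  prohibitively slow on set intervals.
\<close>

lemma all_less_iff_upt: "(\<forall>m<n. P m) \<longleftrightarrow> (\<forall>m\<in>set [0..<n]. P m)"
  by auto

lemma ex_less_iff_upt: "(\<exists>m<n. P m) \<longleftrightarrow> (\<exists>m\<in>set [0..<n]. P m)"
  by auto

text \<open>The bound is \<open>62 = 8 * 7 + 6\<close>: from there on \<open>a\<close> lies in a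
  window \<open>8 * m + u\<close> with \<open>6 \<le> u < 14\<close> and
  \<open>m \<ge> 7\<close>.\<close>

lemma small_check:
  "\<forall>c<8. \<forall>a<62.
     partner c (partner c a) = a \<and>
     (\<forall>d<c. partner d a \<noteq> partner c a) \<and>
     ((a, c) \<noteq> (0, 0) \<longrightarrow> partner (c div 2) (a div 2) \<noteq> partner c a div 2) \<and>
     (\<forall>b\<in>{a..<partner c a}. a < partner c b \<longrightarrow>
        (\<exists>d<c. partner d a = b) \<or> partner (c div 2) (a div 2) = b div 2)"
  unfolding all_less_iff_upt ex_less_iff_upt atLeastLessThan_upt by code_simp

text \<open>
  The partner of \<open>8 * m + u\<close>, relative to \<open>8 * m\<close>, where \<open>e\<close> and \<open>e'\<close> are the octave parities of
  \<open>8 * m\<close> and \<open>8 * (m + 1)\<close>; likewise \<open>local_half\<close> for the partner of its half, relative to \<open>4 * m\<close>.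
  The window \<open>6 \<le> u < 14\<close> is a block of eight values of \<open>a + 2\<close>, but straddles blocks of \<open>a\<close>.
\<close>

definition local_partner :: "bool \<Rightarrow> bool \<Rightarrow> nat \<Rightarrow> nat \<Rightarrow> nat" where
  "local_partner e e' c u = large_partner (if u < 8 then e else e') c u"

definition local_half :: "bool \<Rightarrow> bool \<Rightarrow> nat \<Rightarrow> nat \<Rightarrow> nat" where
  "local_half e e' c u = large_partner (\<not> (if u < 8 then e else e')) c (u div 2)"

text \<open>These are the hypotheses of the three-pile criterion on one window, for all octave
  parities. The bounds \<open>{4..<16}\<close> keep partners where the translation by
  \<open>8 * m\<close> is valid.\<close>

lemma local_check:
  "\<forall>e e'. \<forall>c<8. \<forall>u\<in>{6..<14}.
     local_partner e e' c u \<in> {4..<16} \<and>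
     local_partner e e' c (local_partner e e' c u) = u \<and>
     (\<forall>d<c. local_partner e e' d u \<noteq> local_partner e e' c u) \<and>
     local_half e e' (c div 2) u \<noteq> local_partner e e' c u div 2 \<and>
     (\<forall>v\<in>{u..<local_partner e e' c u}. u < local_partner e e' c v \<longrightarrow>
        (\<exists>d<c. local_partner e e' d u = v) \<or> local_half e e' (c div 2) u = v div 2)"
  unfolding all_bool_eq all_less_iff_upt ex_less_iff_upt atLeastLessThan_upt by code_simp

section \<open>Translation by multiples of powers of two, and octaves\<close>

text \<open>XOR with \<open>d\<close> changes only the lowest \<open>k\<close> bits. Higher bits
  pass through, so \<open>u\<close> itself may exceed \<open>2 ^ k\<close>.\<close>

lemma xor_less_power_of_2:
  fixes m u d :: nat
  assumes "d < 2 ^ k"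
  shows "(2 ^ k * m + u) XOR d = 2 ^ k * m + (u XOR d)"
proof -
  have split: "x XOR d = 2 ^ k * (x div 2 ^ k) + (x mod 2 ^ k XOR d)" for x :: nat
  proof -
    have "take_bit k d = d"
      using assms by (simp add: take_bit_nat_eq_self_iff)
    then have "take_bit k (x XOR d) = x mod 2 ^ k XOR d"
      unfolding take_bit_xor by (simp add: take_bit_eq_mod)
    moreover have "drop_bit k (x XOR d) = x div 2 ^ k"
      unfolding drop_bit_xor using assms by (simp add: drop_bit_eq_div)
    ultimately show ?thesis
      by (metis drop_bit_eq_div mult_div_mod_eq take_bit_eq_mod)
  qed
  show ?thesis
    by (subst (1 2) split) (simp add: algebra_simps)
qed

lemma xor_if_less_4:
  fixes c :: nat
  assumes "c < 4"
  shows "c XOR (if e then 2 else 0) < 4"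
proof -
  have "c \<in> {0, 1, 2, 3}"
    using assms by auto
  then show ?thesis by (auto simp del: One_nat_def)
qed

lemma large_partner_shift:
  assumes "c < 8" "4 \<le> u" "u < 16"
  shows "large_partner e c (8 * m + u) = 8 * m + large_partner e c u"
proof (cases "c < 4")
  case True
  moreover from this have "c XOR (if e then 2 else 0) < 2 ^ 3"
    using xor_if_less_4[of c e] by simp
  ultimately show ?thesis
    using xor_less_power_of_2[of _ 3 m u] by (simp add: large_partner_def)
next
  case False
  \<comment> \<open>This keeps the truncated subtraction of 2 exact; it would fail at
    \<open>u = 3\<close>, \<open>d = 5\<close>.\<close>
  have "\<forall>u\<in>{4..<16::nat}. \<forall>d\<in>{2..<6::nat}. 2 \<le> (u + 2) XOR d"
    unfolding atLeastLessThan_upt by code_simp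
  moreover have "u \<in> {4..<16}" "c - 2 \<in> {2..<6}"
    using assms False by auto
  ultimately have "2 \<le> (u + 2) XOR (c - 2)"
    by blast
  then show ?thesis
    using xor_less_power_of_2[of "c - 2" 3 m "u + 2"] assms False
    by (simp add: large_partner_def)
qed

text \<open>Halving turns \<open>8 * m\<close> into \<open>4 * m\<close>, only a multiple of 4, but
  it also brings \<open>c\<close> below 4, so that two bits suffice.\<close>

lemma large_partner_shift_half:
  assumes "c < 4"
  shows "large_partner e c (4 * m + u) = 4 * m + large_partner e c u"
proof -
  have "c XOR (if e then 2 else 0) < 2 ^ 2"
    using xor_if_less_4[of c e] assms by simp
  then show ?thesis
    using xor_less_power_of_2[of _ 2 m u] assms by (simp add: large_partner_def)
qed

lemma even_octave_half:
  assumes "14 \<le> a"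
  shows "even_octave (a div 2) \<longleftrightarrow> \<not> even_octave a"
proof -
  have "a div 2 div 7 = a div 7 div 2"
    by (simp add: div_mult2_eq[symmetric] mult.commute)
  moreover have "2 \<le> a div 7"
    using assms by simp
  ultimately show ?thesis
    unfolding even_octave_def using floor_log_rec[of "a div 7"] by simp
qed

text \<open>Three halvings send the whole block to \<open>m\<close> and flip the parity three times;
  \<open>7 \<le> m\<close> keeps each halved number at least 14.\<close>

lemma even_octave_shift:
  assumes "7 \<le> m" "u < 8"
  shows "even_octave (8 * m + u) \<longleftrightarrow> even_octave (8 * m)"
proof -
  have "even_octave (8 * m + v) \<longleftrightarrow> \<not> even_octave m" if "v < 8" for v
  proof -
    have "even_octave ((8 * m + v) div 2 div 2 div 2) \<longleftrightarrow> \<not> even_octave (8 * m + v)"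
      using assms that by (subst even_octave_half, simp)+ simp
    moreover have "(8 * m + v) div 2 div 2 div 2 = m"
      using that by (simp add: div_mult2_eq[symmetric])
    ultimately show ?thesis by simp
  qed
  from this[of u] this[of 0] show ?thesis
    using assms by simp
qed

lemma partner_eq_local_partner:
  assumes "7 \<le> m" "c < 8" "4 \<le> u" "u < 16"
  shows "partner c (8 * m + u) =
    8 * m + local_partner (even_octave (8 * m)) (even_octave (8 * (m + 1))) c u"
proof -
  have "even_octave (8 * m + u) \<longleftrightarrow>
      (if u < 8 then even_octave (8 * m) else even_octave (8 * (m + 1)))"
    using even_octave_shift[of m u] even_octave_shift[of "m + 1" "u - 8"] assms by auto
  then show ?thesis
    using assms large_partner_shift by (simp add: partner_def local_partner_def)
qed

lemma partner_eq_local_half: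
  assumes "7 \<le> m" "c < 4" "6 \<le> u" "u < 16"
  shows "partner c ((8 * m + u) div 2) =
    4 * m + local_half (even_octave (8 * m)) (even_octave (8 * (m + 1))) c u"
proof -
  have "even_octave ((8 * m + u) div 2) \<longleftrightarrow>
      \<not> (if u < 8 then even_octave (8 * m) else even_octave (8 * (m + 1)))"
    using even_octave_shift[of m u] even_octave_shift[of "m + 1" "u - 8"] assms
    by (subst even_octave_half) auto
  moreover have "(8 * m + u) div 2 = 4 * m + u div 2"
    by simp
  \<comment> \<open>The half must also lie beyond the table; this uses
    \<open>7 \<le> m\<close>.\<close>
  moreover have "30 \<le> 4 * m + u div 2"
    using assms by linarith
  ultimately show ?thesis
    using assms large_partner_shift_half by (simp add: partner_def local_half_def)
qed

section \<open>From the finite checks to all positions\<close>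

lemma partner_properties:
  assumes "c < 8"
  shows
    "partner c (partner c a) = a \<and>
     (\<forall>d<c. partner d a \<noteq> partner c a) \<and>
     ((a, c) \<noteq> (0, 0) \<longrightarrow> partner (c div 2) (a div 2) \<noteq> partner c a div 2) \<and>
     (\<forall>b\<in>{a..<partner c a}. a < partner c b \<longrightarrow>
        (\<exists>d<c. partner d a = b) \<or> partner (c div 2) (a div 2) = b div 2)"
proof (cases "a < 62")
  case True
  then show ?thesis
    using small_check assms by blast
next
  case False
  \<comment> \<open>The offset 6 aligns the window with a block of eight values of
    \<open>a + 2\<close>, since \<open>a + 2 = 8 * (m + 1) + (u - 6)\<close>.\<close>
  define m where "m = (a - 6) div 8"
  define u where "u = (a - 6) mod 8 + 6"
  have a: "a = 8 * m + u" and u: "6 \<le> u" "u < 14" and m: "7 \<le> m"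
    using False by (auto simp: m_def u_def)
  let ?e = "even_octave (8 * m)" and ?e' = "even_octave (8 * (m + 1))"
  let ?L = "local_partner ?e ?e'" and ?H = "local_half ?e ?e'"
  have check: "?L c u \<in> {4..<16}" "?L c (?L c u) = u" "\<And>d. d < c \<Longrightarrow> ?L d u \<noteq> ?L c u"
      "?H (c div 2) u \<noteq> ?L c u div 2"
      "\<And>v. v \<in> {u..<?L c u} \<Longrightarrow> u < ?L c v \<Longrightarrow>
        (\<exists>d<c. ?L d u = v) \<or> ?H (c div 2) u = v div 2"
    using local_check assms u by (simp_all del: One_nat_def)
  have L: "partner d (8 * m + v) = 8 * m + ?L d v" if "d \<le> c" "4 \<le> v" "v < 16" for d v
    using partner_eq_local_partner m assms that by simp
  have H: "partner (c div 2) (a div 2) = 4 * m + ?H (c div 2) u"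
    using partner_eq_local_half m assms u a by simp
  have "partner c (partner c a) = a"
    using check(1,2) L u by (simp add: a)
  moreover have "\<forall>d<c. partner d a \<noteq> partner c a"
    using check(3) L u by (simp add: a)
  moreover have "partner (c div 2) (a div 2) \<noteq> partner c a div 2"
    using check(4) L u unfolding H by (simp add: a)
  moreover have "\<forall>b\<in>{a..<partner c a}. a < partner c b \<longrightarrow>
      (\<exists>d<c. partner d a = b) \<or> partner (c div 2) (a div 2) = b div 2"
  proof (intro ballI impI)
    fix b assume "b \<in> {a..<partner c a}" and b3: "a < partner c b"
    then have b: "a \<le> b" "b < partner c a" by auto
    obtain v where v: "b = 8 * m + v"
      using b(1) a by (metis add.assoc le_iff_add)
    \<comment> \<open>As \<open>?L c u < 16\<close>, such a \<open>v\<close> stays in the range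
      where \<open>L\<close> applies.\<close>
    have "v \<in> {u..<?L c u}"
      using b L u by (simp add: a v)
    moreover from this have "u < ?L c v"
      using b3 L u check(1) by (simp add: a v)
    ultimately have "(\<exists>d<c. ?L d u = v) \<or> ?H (c div 2) u = v div 2"
      by (rule check(5))
    then show "(\<exists>d<c. partner d a = b) \<or> partner (c div 2) (a div 2) = b div 2"
    proof
      assume "\<exists>d<c. ?L d u = v"
      then show ?thesis
        using L u by (auto simp: a v)
    next
      assume "?H (c div 2) u = v div 2"
      then have "partner (c div 2) (a div 2) = b div 2"
        unfolding H v by simp
      then show ?thesis ..
    qed
  qed
  ultimately show ?thesis by blast
qed

lemma P_position_iff_partner:
  assumes "c < 8"
  shows "P_position {#a, b, c#} \<longleftrightarrow> partner c a = b"
proof (rule P_position_three_piles_iff[where n = 8])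
  fix c a :: nat assume "c < 8"
  note properties = partner_properties[OF this, of a]
  from properties show "partner c (partner c a) = a"
    by blast
  from properties show "partner d a \<noteq> partner c a" if "d < c" for d
    using that by blast
  from properties show "partner (c div 2) (a div 2) \<noteq> partner c a div 2" if "(a, c) \<noteq> (0, 0)"
    using that by blast
  from properties show "(\<exists>d<c. partner d a = b) \<or> partner (c div 2) (a div 2) = b div 2"
    if "a \<le> b" "b < partner c a" "a < partner c b" for b
    using that by (meson atLeastLessThan_iff)
qed (fact assms)

section \<open>Comparison with the stated formulas\<close>

text \<open>Both exponents are the \<open>k\<close> with
  \<open>7 * 2 ^ k \<le> a < 7 * 2 ^ (k + 1)\<close>; rounding \<open>a / 7\<close> down does not
  cross a power of two.\<close>

lemma even_floor_log2_iff_even_octave: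
  assumes "7 \<le> a"
  shows "even \<lfloor>log 2 (real a / 7)\<rfloor> \<longleftrightarrow> even_octave a"
proof -
  define k where "k = floor_log (a div 7)"
  have "0 < a div 7"
    using assms by (simp add: div_greater_zero_iff)
  then have "2 ^ k \<le> a div 7" "a div 7 < 2 * 2 ^ k"
    unfolding k_def using floor_log_exp2_le floor_log_exp2_gt by auto
  then have "2 ^ k * 7 \<le> a" "a < 2 ^ Suc k * 7"
    by (auto simp: less_eq_div_iff_mult_less_eq div_less_iff_less_mult)
  then have "real (2 ^ k * 7) \<le> real a" "real a < real (2 ^ Suc k * 7)"
    by (simp_all only: of_nat_le_iff of_nat_less_iff)
  then have "2 powr of_int (int k) \<le> real a / 7" "real a / 7 < 2 powr (of_int (int k) + 1)"
    by (simp_all add: powr_realpow powr_add)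
  then have "\<lfloor>log 2 (real a / 7)\<rfloor> = int k"
    using assms by (subst floor_log_eq_powr_iff) auto
  then show ?thesis
    by (simp add: even_octave_def k_def)
qed

theorem theorem8:
  fixes a b c :: nat
  assumes "a \<ge> 30" and "b \<ge> 30"
  shows "(0 \<le> c \<and> c \<le> 3 \<longrightarrow>
      (P_position {#a, b, c#} \<longleftrightarrow>
        real (a XOR b) = 1 / 2 * (3 + (- 1) ^ (c + 1))
          + (- 1) powi (\<lfloor>log 2 (real a / 7)\<rfloor> + (1 + (- 1) ^ (c div 2 + 1)) div 2))) \<and>
    (4 \<le> c \<and> c \<le> 7 \<longrightarrow>
      (P_position {#a, b, c#} \<longleftrightarrow> int ((a + 2) XOR (b + 2)) = int c - 2))"
proof (intro conjI impI; elim conjE)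
  have xor_eq_iff: "x XOR d = y \<longleftrightarrow> x XOR y = d" for x d y :: nat
    by (metis xor.left_commute xor.right_neutral xor_self_eq)
  {
    assume c: "c \<le> 3"
    define e where "e = even_octave a"
    have "P_position {#a, b, c#} \<longleftrightarrow> a XOR b = c XOR (if e then 2 else 0)"
      using P_position_iff_partner[of c a b] assms c
      by (simp add: partner_def large_partner_def e_def xor_eq_iff)
    \<comment> \<open>The first term is 1 for even \<open>c\<close> and 2 for odd \<open>c\<close>.
      The summand added to the logarithm is 0 for \<open>c < 2\<close> and 1 otherwise, so the sign
      depends on \<open>e\<close> and the second bit of \<open>c\<close>.\<close>
    moreover have "1 / 2 * (3 + (- 1) ^ (c + 1))
          + (- 1) powi (\<lfloor>log 2 (real a / 7)\<rfloor> + (1 + (- 1) ^ (c div 2 + 1)) div 2)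
        = real (c XOR (if e then 2 else 0))"
    proof -
      have "(- 1 :: real) powi k = (if even k then 1 else - 1)" for k
        by (simp add: power_int_minus_one_minus)
      moreover have "even \<lfloor>log 2 (real a / 7)\<rfloor> \<longleftrightarrow> e"
        unfolding e_def using assms by (intro even_floor_log2_iff_even_octave) simp
      moreover have "c \<in> {0, 1, 2, 3}"
        using c by auto
      ultimately show ?thesis
        by auto
    qed
    ultimately show "P_position {#a, b, c#} \<longleftrightarrow>
        real (a XOR b) = 1 / 2 * (3 + (- 1) ^ (c + 1))
          + (- 1) powi (\<lfloor>log 2 (real a / 7)\<rfloor> + (1 + (- 1) ^ (c div 2 + 1)) div 2)"
      by (simp only: of_nat_eq_iff)
  next
    assume c: "4 \<le> c" "c \<le> 7"
    \<comment> \<open>XOR with \<open>c - 2 < 8\<close> preserves the part of \<open>a + 2\<close>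
      above the low three bits, so the truncated \<open>- 2\<close> in \<open>large_partner\<close>
      can be undone.\<close>
    have "(a + 2) XOR (c - 2) = 8 * ((a + 2) div 8) + ((a + 2) mod 8 XOR (c - 2))"
      using xor_less_power_of_2[of "c - 2" 3 "(a + 2) div 8" "(a + 2) mod 8"] c by simp
    moreover have "1 \<le> (a + 2) div 8"
      using assms by simp
    ultimately have "2 \<le> (a + 2) XOR (c - 2)"
      by linarith
    then have "P_position {#a, b, c#} \<longleftrightarrow> (a + 2) XOR (c - 2) = b + 2"
      using P_position_iff_partner[of c a b] assms c
      by (auto simp: partner_def large_partner_def)
    also have "\<dots> \<longleftrightarrow> (a + 2) XOR (b + 2) = c - 2"
      by (rule xor_eq_iff)
    also have "\<dots> \<longleftrightarrow> int ((a + 2) XOR (b + 2)) = int c - 2"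
      using c by linarith
    finally show "P_position {#a, b, c#} \<longleftrightarrow> int ((a + 2) XOR (b + 2)) = int c - 2" .
  }
qed

end
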